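(* Let $F$ be an unsatisfiable CNF formula and let $d$ be the minimum width (equivalently, conical junta degree) of a SubCubeSums refutation of $F$. Then every SubCubeSums refutation of $F\circ\oplus$ has combinatorial size $\exp(\Omega(d))$; that is, there are absolute constants $\varepsilon>0$ and $d_0$ such that, whenever $d\ge d_0$, every SubCubeSums refutation of $F\circ\oplus$ has combinatorial size at least $2^{\varepsilon d}$.
   Context: For a multi-set $F$ of clauses and a total assignment $\alpha$, $\mathrm{viol}_F(\alpha)$ is the number of clauses of $F$ (with multiplicity) falsified by $\alpha$. A SubCubeSums refutation of an unsatisfiable CNF $F$ over variables $X$ is a multi-set $H$ of non-tautologous clauses over $X$ with $\mathrm{viol}_F(\alpha)=1+\mathrm{viol}_H(\alpha)$ for all $\alpha\in\{0,1\}^X$. Its combinatorial size is the number of clauses of $H$ counted with multiplicity; its width (also called conical junta degree) is the maximum number of literals in a clause of $H$ (and $0$ if $H$ is empty). $F\circ\oplus$: replace each variable $x$ of $F$ by two new variables $x_1,x_2$. For each clause $C\in F$ on $w$ variables, include the CNF expansion of the statement that $C$ holds with each $x$ replaced by $x_1\oplus x_2$: for each of the $2^w$ assignments to the $2w$ new variables that falsify this statement, the width-$2w$ clause falsified exactly by that assignment. *)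

theory Defs
  imports Complex_Main "HOL-Library.Multiset" "HOL-Library.FuncSet"
begin

datatype 'v literal = Pos 'v | Neg 'v

fun lit_var :: "'v literal \<Rightarrow> 'v" where
  "lit_var (Pos x) = x"
| "lit_var (Neg x) = x"

fun lit_true :: "('v \<Rightarrow> bool) \<Rightarrow> 'v literal \<Rightarrow> bool" where
  "lit_true \<alpha> (Pos x) \<longleftrightarrow> \<alpha> x"
| "lit_true \<alpha> (Neg x) \<longleftrightarrow> \<not> \<alpha> x"

type_synonym 'v clause = "'v literal set"

definition clause_vars :: "'v clause \<Rightarrow> 'v set" where
  "clause_vars C = lit_var ` C"

definition clause_true :: "('v \<Rightarrow> bool) \<Rightarrow> 'v clause \<Rightarrow> bool" where
  "clause_true \<alpha> C \<longleftrightarrow> (\<exists>l\<in>C. lit_true \<alpha> l)"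

definition tautologous :: "'v clause \<Rightarrow> bool" where
  "tautologous C \<longleftrightarrow> (\<exists>x. Pos x \<in> C \<and> Neg x \<in> C)"

text \<open>
  A CNF formula is a multiset of clauses. Its variable set \<open>X\<close> is a parameter; it may contain
  variables not occurring in the formula. With \<open>X\<close> finite, clauses over \<open>X\<close> are finite.
\<close>
definition clauses_over :: "'v set \<Rightarrow> 'v clause multiset \<Rightarrow> bool" where
  "clauses_over X F \<longleftrightarrow> (\<forall>C\<in>#F. clause_vars C \<subseteq> X)"

definition unsatisfiable :: "'v clause multiset \<Rightarrow> bool" where
  "unsatisfiable F \<longleftrightarrow> (\<forall>\<alpha>. \<exists>C\<in>#F. \<not> clause_true \<alpha> C)"

definition viol :: "'v clause multiset \<Rightarrow> ('v \<Rightarrow> bool) \<Rightarrow> nat" where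
  "viol F \<alpha> = size {#C \<in># F. \<not> clause_true \<alpha> C#}"

text \<open>
  Assignments in \<open>{0,1}\<^sup>X\<close> are represented by functions on the whole type; for clauses over \<open>X\<close>
  the values outside \<open>X\<close> are irrelevant.
\<close>
definition subcubesums_refutation ::
    "'v set \<Rightarrow> 'v clause multiset \<Rightarrow> 'v clause multiset \<Rightarrow> bool" where
  "subcubesums_refutation X F H \<longleftrightarrow>
     clauses_over X H \<and> (\<forall>C\<in>#H. \<not> tautologous C) \<and> (\<forall>\<alpha>. viol F \<alpha> = 1 + viol H \<alpha>)"

definition refutation_width :: "'v clause multiset \<Rightarrow> nat" where
  "refutation_width H = Max (insert 0 (card ` set_mset H))"

definition min_refutation_width :: "'v set \<Rightarrow> 'v clause multiset \<Rightarrow> nat" where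
  "min_refutation_width X F =
     (LEAST w. \<exists>H. subcubesums_refutation X F H \<and> refutation_width H = w)"

text \<open>
  The two new variables replacing \<open>x\<close> are \<open>(x, False)\<close> and \<open>(x, True)\<close>; inequality of truth
  values is exclusive or.
\<close>
definition xor_assignment :: "('v \<times> bool \<Rightarrow> bool) \<Rightarrow> 'v \<Rightarrow> bool" where
  "xor_assignment \<beta> x \<longleftrightarrow> \<beta> (x, False) \<noteq> \<beta> (x, True)"

text \<open>The clause on the variables \<open>V\<close> falsified exactly by the assignment \<open>\<beta>\<close> to \<open>V\<close>:\<close>
definition falsified_clause :: "'v set \<Rightarrow> ('v \<Rightarrow> bool) \<Rightarrow> 'v clause" where
  "falsified_clause V \<beta> = (\<lambda>v. if \<beta> v then Neg v else Pos v) ` V"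

text \<open>
  A non-tautologous clause on \<open>w\<close> variables yields \<open>2 ^ w\<close> clauses of width \<open>2 * w\<close>; a tautologous
  clause has no falsifying assignment and yields none.
\<close>
definition xorify_clause :: "'v clause \<Rightarrow> ('v \<times> bool) clause multiset" where
  "xorify_clause C =
     (let V = clause_vars C \<times> (UNIV :: bool set)
      in image_mset (falsified_clause V)
           (mset_set {\<beta> \<in> V \<rightarrow>\<^sub>E UNIV. \<not> clause_true (xor_assignment \<beta>) C}))"

definition xorify :: "'v clause multiset \<Rightarrow> ('v \<times> bool) clause multiset" where
  "xorify F = (\<Sum>C\<in>#F. xorify_clause C)"

end

theory Submission
  imports Defs
begin

text \<open>
  Random restriction: for every variable \<open>x\<close> of \<open>F\<close>, fix one of the two new variables of \<open>x\<close>, chosen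
  at random, to a random value. The other one then plays the role of \<open>x\<close> or of its negation, so
  a refutation of the lifted formula becomes a refutation of \<open>F\<close>. A clause that touches at least
  \<open>d\<close> of the variables of \<open>F\<close> survives with probability at most \<open>(3/4) ^ d\<close>. By the union bound,
  a refutation of size less than \<open>(4/3) ^ d\<close> would yield a refutation of \<open>F\<close> of width less than \<open>d\<close>.
\<close>

section \<open>Violated clauses of the lifted formula\<close>

lemma viol_empty [simp]: "viol {#} \<alpha> = 0"
  by (simp add: viol_def)

lemma viol_union [simp]: "viol (F + G) \<alpha> = viol F \<alpha> + viol G \<alpha>"
  by (simp add: viol_def)

lemma viol_add_mset:
  "viol (add_mset C F) \<alpha> = (if clause_true \<alpha> C then 0 else 1) + viol F \<alpha>"
  by (simp add: viol_def)

lemma clause_true_falsified_clause: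
  "clause_true \<beta> (falsified_clause V \<gamma>) \<longleftrightarrow> (\<exists>v\<in>V. \<beta> v \<noteq> \<gamma> v)"
proof -
  have "lit_true \<beta> (if \<gamma> v then Neg v else Pos v) \<longleftrightarrow> \<beta> v \<noteq> \<gamma> v" for v
    by simp
  then show ?thesis
    by (simp only: clause_true_def falsified_clause_def bex_simps)
qed

lemma clause_true_cong:
  assumes "\<And>x. x \<in> clause_vars C \<Longrightarrow> \<alpha> x = \<beta> x"
  shows "clause_true \<alpha> C = clause_true \<beta> C"
proof -
  have "lit_true \<alpha> l = lit_true \<beta> l" if "l \<in> C" for l
    using assms[of "lit_var l"] imageI[OF that, of lit_var]
    by (cases l) (simp_all add: clause_vars_def)
  then show ?thesis by (auto simp: clause_true_def)
qed

text \<open>Only the clause built from \<open>restrict \<beta> V\<close> can be falsified by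
  \<open>\<beta>\<close>, and it occurs exactly when \<open>\<beta>\<close> falsifies the lifted
  statement. Finiteness keeps \<open>mset_set\<close> from defaulting to \<open>{#}\<close>.\<close>

lemma viol_xorify_clause:
  assumes "finite (clause_vars C)"
  shows "viol (xorify_clause C) \<beta> = (if clause_true (xor_assignment \<beta>) C then 0 else 1)"
proof -
  define V where "V = clause_vars C \<times> (UNIV :: bool set)"
  define S where "S = {\<gamma> \<in> V \<rightarrow>\<^sub>E UNIV. \<not> clause_true (xor_assignment \<gamma>) C}"
  have "finite (V \<rightarrow>\<^sub>E (UNIV :: bool set))"
    using assms by (intro finite_PiE) (auto simp: V_def)
  then have "finite S" by (simp add: S_def)
  have restr: "clause_true (xor_assignment (restrict \<beta> V)) C = clause_true (xor_assignment \<beta>) C"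
    by (rule clause_true_cong) (simp add: xor_assignment_def V_def)
  have "viol (xorify_clause C) \<beta> = card {\<gamma> \<in> S. \<forall>v\<in>V. \<beta> v = \<gamma> v}"
    using \<open>finite S\<close>
    by (simp add: viol_def xorify_clause_def Let_def filter_mset_image_mset
        clause_true_falsified_clause flip: V_def S_def)
  also have "{\<gamma> \<in> S. \<forall>v\<in>V. \<beta> v = \<gamma> v} = S \<inter> {restrict \<beta> V}"
    by (auto simp: S_def fun_eq_iff PiE_def extensional_def)
  also have "card \<dots> = (if clause_true (xor_assignment \<beta>) C then 0 else 1)"
    using restr by (auto simp: S_def)
  finally show ?thesis .
qed

lemma viol_xorify:
  assumes "finite X" and "clauses_over X F"
  shows "viol (xorify F) \<beta> = viol F (xor_assignment \<beta>)"
  using assms(2)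
proof (induction F)
  case empty
  then show ?case by (simp add: xorify_def)
next
  case (add C F)
  then have "finite (clause_vars C)"
    using assms(1) by (auto simp: clauses_over_def intro: finite_subset)
  with add show ?case
    by (simp add: xorify_def viol_add_mset viol_xorify_clause clauses_over_def)
qed

section \<open>Restrictions\<close>

text \<open>
  A restriction \<open>\<rho>\<close> with \<open>\<rho> x = (b, v)\<close> gives the variable \<open>(x, b)\<close> the value \<open>v\<close>, which turns
  \<open>(x, \<not> b)\<close> into the exclusive or of \<open>x\<close> and \<open>v\<close>.
\<close>

type_synonym 'v restriction = "'v \<Rightarrow> bool \<times> bool"

definition extend_assignment ::
    "'v restriction \<Rightarrow> ('v \<Rightarrow> bool) \<Rightarrow> 'v \<times> bool \<Rightarrow> bool" where
  "extend_assignment \<rho> \<alpha> =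
     (\<lambda>(x, c). if c = fst (\<rho> x) then snd (\<rho> x) else \<alpha> x \<noteq> snd (\<rho> x))"

definition fixed_literal :: "'v restriction \<Rightarrow> ('v \<times> bool) literal \<Rightarrow> bool" where
  "fixed_literal \<rho> l \<longleftrightarrow> snd (lit_var l) = fst (\<rho> (fst (lit_var l)))"

definition satisfied_by :: "'v restriction \<Rightarrow> ('v \<times> bool) clause \<Rightarrow> bool" where
  "satisfied_by \<rho> C \<longleftrightarrow> (\<exists>l\<in>C. fixed_literal \<rho> l \<and> lit_true (\<lambda>(x, c). snd (\<rho> x)) l)"

text \<open>The tag \<open>c\<close> may be ignored because only unfixed literals matter, and for
  these \<open>c\<close> is the negation of \<open>fst (\<rho> x)\<close>.\<close>

fun restrict_literal :: "'v restriction \<Rightarrow> ('v \<times> bool) literal \<Rightarrow> 'v literal" where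
  "restrict_literal \<rho> (Pos (x, c)) = (if snd (\<rho> x) then Neg x else Pos x)"
| "restrict_literal \<rho> (Neg (x, c)) = (if snd (\<rho> x) then Pos x else Neg x)"

definition restrict_clause :: "'v restriction \<Rightarrow> ('v \<times> bool) clause \<Rightarrow> 'v clause" where
  "restrict_clause \<rho> C = restrict_literal \<rho> ` {l \<in> C. \<not> fixed_literal \<rho> l}"

text \<open>Distinct clauses may restrict to the same clause; \<open>image_mset\<close> keeps every
  copy, so violation counts are preserved.\<close>

definition restrict_cnf :: "'v restriction \<Rightarrow> ('v \<times> bool) clause multiset \<Rightarrow> 'v clause multiset" where
  "restrict_cnf \<rho> H = image_mset (restrict_clause \<rho>) {#C \<in># H. \<not> satisfied_by \<rho> C#}"

text \<open>The fixed copy carries \<open>v\<close> and the free copy carries the exclusive or of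
  \<open>\<alpha> x\<close> and \<open>v\<close>, so \<open>v\<close> cancels.\<close>

lemma xor_extend_assignment [simp]: "xor_assignment (extend_assignment \<rho> \<alpha>) = \<alpha>"
  by (auto simp: fun_eq_iff xor_assignment_def extend_assignment_def)

lemma lit_true_extend_assignment:
  "lit_true (extend_assignment \<rho> \<alpha>) l \<longleftrightarrow>
     (if fixed_literal \<rho> l then lit_true (\<lambda>(x, c). snd (\<rho> x)) l
      else lit_true \<alpha> (restrict_literal \<rho> l))"
  by (induction \<rho> l rule: restrict_literal.induct)
    (auto simp: extend_assignment_def fixed_literal_def)

lemma clause_true_extend_assignment:
  "clause_true (extend_assignment \<rho> \<alpha>) C \<longleftrightarrow>
     satisfied_by \<rho> C \<or> clause_true \<alpha> (restrict_clause \<rho> C)"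
  by (auto simp: clause_true_def satisfied_by_def restrict_clause_def lit_true_extend_assignment)

lemma viol_restrict_cnf: "viol (restrict_cnf \<rho> H) \<alpha> = viol H (extend_assignment \<rho> \<alpha>)"
  by (induction H) (auto simp: restrict_cnf_def viol_add_mset clause_true_extend_assignment)

lemma lit_var_restrict_literal [simp]: "lit_var (restrict_literal \<rho> l) = fst (lit_var l)"
  by (induction \<rho> l rule: restrict_literal.induct) auto

lemma clause_vars_restrict_clause: "clause_vars (restrict_clause \<rho> C) \<subseteq> fst ` clause_vars C"
  by (auto simp: clause_vars_def restrict_clause_def)

text \<open>Only one copy of \<open>x\<close> is free, so the literal before restriction can be
  recovered.\<close>

lemma restrict_literal_eq_Pos:
  assumes "restrict_literal \<rho> l = Pos x" and "\<not> fixed_literal \<rho> l"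
  shows "l = (if snd (\<rho> x) then Neg (x, \<not> fst (\<rho> x)) else Pos (x, \<not> fst (\<rho> x)))"
  using assms
  by (induction \<rho> l rule: restrict_literal.induct) (auto simp: fixed_literal_def split: if_splits)

lemma restrict_literal_eq_Neg:
  assumes "restrict_literal \<rho> l = Neg x" and "\<not> fixed_literal \<rho> l"
  shows "l = (if snd (\<rho> x) then Pos (x, \<not> fst (\<rho> x)) else Neg (x, \<not> fst (\<rho> x)))"
  using assms
  by (induction \<rho> l rule: restrict_literal.induct) (auto simp: fixed_literal_def split: if_splits)

text \<open>Complementary literals over \<open>x\<close> can only come from complementary literals
  over its single free copy.\<close>

lemma tautologous_restrict_clause:
  assumes "tautologous (restrict_clause \<rho> C)"
  shows "tautologous C"
proof -
  obtain x l m where "l \<in> C" "m \<in> C" "\<not> fixed_literal \<rho> l" "\<not> fixed_literal \<rho> m"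
    and "restrict_literal \<rho> l = Pos x" "restrict_literal \<rho> m = Neg x"
    using assms unfolding tautologous_def restrict_clause_def
    by (smt (verit) image_iff mem_Collect_eq)
  then show ?thesis
    using restrict_literal_eq_Pos[of \<rho> l x] restrict_literal_eq_Neg[of \<rho> m x]
    unfolding tautologous_def by (cases "snd (\<rho> x)") auto
qed

lemma card_clause_vars:
  assumes "\<not> tautologous C"
  shows "card (clause_vars C) = card C"
proof -
  have "l = m" if "l \<in> C" "m \<in> C" "lit_var l = lit_var m" for l m
    using that assms by (cases l; cases m) (auto simp: tautologous_def)
  then show ?thesis
    unfolding clause_vars_def by (intro card_image inj_onI)
qed

text \<open>The identity for \<open>H\<close> is evaluated at
  \<open>extend_assignment \<rho> \<alpha>\<close>, whose exclusive or is \<open>\<alpha>\<close>: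
  the left side becomes \<open>viol F \<alpha>\<close>, the right side the count for the restricted
  clauses.\<close>

lemma subcubesums_refutation_restrict_cnf:
  assumes "finite X" and "clauses_over X F"
    and "subcubesums_refutation (X \<times> UNIV) (xorify F) H"
  shows "subcubesums_refutation X F (restrict_cnf \<rho> H)"
proof -
  have "viol F \<alpha> = 1 + viol (restrict_cnf \<rho> H) \<alpha>" for \<alpha>
    using viol_xorify[OF assms(1,2), of "extend_assignment \<rho> \<alpha>"] assms(3)
    by (simp add: subcubesums_refutation_def viol_restrict_cnf)
  moreover have "clauses_over X (restrict_cnf \<rho> H)"
    using assms(3) clause_vars_restrict_clause
    unfolding subcubesums_refutation_def clauses_over_def restrict_cnf_def by fastforce
  moreover have "\<not> tautologous C" if "C \<in># restrict_cnf \<rho> H" for C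
    using that assms(3) tautologous_restrict_clause
    by (auto simp: subcubesums_refutation_def restrict_cnf_def)
  ultimately show ?thesis by (simp add: subcubesums_refutation_def)
qed

text \<open>A non-tautologous restricted clause has at most one literal per variable of
  \<open>X\<close> touched by the original clause, so counting touched variables bounds the
  width.\<close>

lemma refutation_width_restrict_cnf_less:
  assumes "finite X" and "0 < d"
    and over: "clauses_over (X \<times> UNIV) H" and nontaut: "\<forall>C\<in>#H. \<not> tautologous C"
    and surv: "\<And>C. C \<in># H \<Longrightarrow> \<not> satisfied_by \<rho> C \<Longrightarrow> card (fst ` clause_vars C) < d"
  shows "refutation_width (restrict_cnf \<rho> H) < d"
proof -
  have "card (restrict_clause \<rho> C) < d" if "C \<in># H" "\<not> satisfied_by \<rho> C" for C
  proof -
    have "fst ` clause_vars C \<subseteq> X"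
      using over that by (fastforce simp: clauses_over_def)
    then have "finite (fst ` clause_vars C)"
      using \<open>finite X\<close> finite_subset by blast
    then have "card (clause_vars (restrict_clause \<rho> C)) \<le> card (fst ` clause_vars C)"
      by (intro card_mono clause_vars_restrict_clause)
    moreover have "\<not> tautologous (restrict_clause \<rho> C)"
      using nontaut that(1) tautologous_restrict_clause by blast
    ultimately show ?thesis
      using card_clause_vars surv[OF that] by fastforce
  qed
  \<comment> \<open>Positivity of \<open>d\<close> handles the default 0 inserted into the
    maximum.\<close>
  then show ?thesis
    using \<open>0 < d\<close> by (auto simp: refutation_width_def restrict_cnf_def)
qed

section \<open>The union bound over all restrictions\<close>

text \<open>At each touched variable at least one of the four choices makes a literal of
  \<open>C\<close> true, leaving survivors at most three; untouched variables keep all four.\<close>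

lemma card_surviving_restrictions:
  assumes "finite X" and "clause_vars C \<subseteq> X \<times> UNIV"
  shows "real (card {\<rho> \<in> X \<rightarrow>\<^sub>E UNIV. \<not> satisfied_by \<rho> C})
           \<le> (3/4) ^ card (fst ` clause_vars C) * 4 ^ card X"
proof -
  define B where "B = fst ` clause_vars C"
  have "B \<subseteq> X" using assms(2) by (auto simp: B_def)
  have "\<exists>p. \<forall>\<rho>. \<rho> x = p \<longrightarrow> satisfied_by \<rho> C" if x: "x \<in> B" for x
  proof -
    obtain l where l: "l \<in> C" "fst (lit_var l) = x"
      using x unfolding B_def clause_vars_def by blast
    \<comment> \<open>The value that makes \<open>l\<close> true once its variable is the fixed
      copy.\<close>
    define v where "v = (case l of Pos _ \<Rightarrow> True | Neg _ \<Rightarrow> False)"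
    have "satisfied_by \<rho> C" if "\<rho> x = (snd (lit_var l), v)" for \<rho>
    proof -
      have "fixed_literal \<rho> l \<and> lit_true (\<lambda>(x, c). snd (\<rho> x)) l"
        using l(2) that by (cases l) (simp_all add: fixed_literal_def v_def case_prod_beta)
      with l(1) show ?thesis by (auto simp: satisfied_by_def)
    qed
    then show ?thesis by blast
  qed
  then obtain p where p: "\<And>x \<rho>. x \<in> B \<Longrightarrow> \<rho> x = p x \<Longrightarrow> satisfied_by \<rho> C"
    by metis
  \<comment> \<open>The choices at \<open>x\<close> that avoid the known satisfying one; their
    product contains all survivors.\<close>
  define A where "A x = (if x \<in> B then UNIV - {p x} else UNIV)" for x
  have card_A: "card (A x) = (if x \<in> B then 3 else 4)" for x
  proof -
    have "card (UNIV :: (bool \<times> bool) set) = 4"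
      by (simp flip: UNIV_Times_UNIV add: card_cartesian_product)
    then show ?thesis by (simp add: A_def card_Diff_singleton)
  qed
  have "{\<rho> \<in> X \<rightarrow>\<^sub>E UNIV. \<not> satisfied_by \<rho> C} \<subseteq> PiE X A"
    using p by (auto simp: A_def PiE_def)
  moreover have "finite (PiE X A)"
    using \<open>finite X\<close> by (intro finite_PiE) auto
  ultimately have "card {\<rho> \<in> X \<rightarrow>\<^sub>E UNIV. \<not> satisfied_by \<rho> C} \<le> card (PiE X A)"
    by (rule card_mono[rotated])
  also have "\<dots> = (\<Prod>x\<in>X. if x \<in> B then 3 else 4)"
    using \<open>finite X\<close> by (simp add: card_PiE card_A)
  also have "\<dots> = 3 ^ card B * 4 ^ card (X - B)"
    using \<open>finite X\<close> \<open>B \<subseteq> X\<close> by (simp add: prod.If_cases Int_absorb1 Diff_eq)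
  finally have "real (card {\<rho> \<in> X \<rightarrow>\<^sub>E UNIV. \<not> satisfied_by \<rho> C})
      \<le> real (3 ^ card B * 4 ^ card (X - B))"
    by (rule of_nat_mono)
  also have "\<dots> = (3/4) ^ card B * 4 ^ (card B + card (X - B))"
    by (simp add: power_add power_divide)
  also have "card B + card (X - B) = card X"
    using \<open>finite X\<close> \<open>B \<subseteq> X\<close> by (metis card_Diff_subset card_mono finite_subset le_add_diff_inverse)
  finally show ?thesis by (simp add: B_def)
qed

lemma card_set_mset_le_size: "card (set_mset M) \<le> size M"
  by (induction M) (auto simp: card_insert_if)

lemma exists_restriction_satisfying_wide_clauses:
  assumes "finite X" and over: "clauses_over (X \<times> UNIV) H"
    and small: "real (size H) < (4/3) ^ d"
  shows "\<exists>\<rho>. \<forall>C\<in>#H. \<not> satisfied_by \<rho> C \<longrightarrow> card (fst ` clause_vars C) < d"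
proof (rule ccontr)
  assume none: "\<not> ?thesis"
  define W where "W = {C \<in> set_mset H. d \<le> card (fst ` clause_vars C)}"
  define S where "S C = {\<rho> \<in> X \<rightarrow>\<^sub>E UNIV. \<not> satisfied_by \<rho> C}" for C :: "('a \<times> bool) clause"
  have fin: "finite (X \<rightarrow>\<^sub>E (UNIV :: (bool \<times> bool) set))"
    using \<open>finite X\<close> by (intro finite_PiE) auto
  \<comment> \<open>If no restriction is good, each one leaves some wide clause unsatisfied.\<close>
  have "(X \<rightarrow>\<^sub>E UNIV) \<subseteq> (\<Union>C\<in>W. S C)"
    using none by (fastforce simp: W_def S_def not_less)
  then have "card (X \<rightarrow>\<^sub>E (UNIV :: (bool \<times> bool) set)) \<le> card (\<Union>C\<in>W. S C)"
    using fin by (intro card_mono) (auto simp: W_def S_def)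
  also have "\<dots> \<le> (\<Sum>C\<in>W. card (S C))"
    by (rule card_UN_le) (simp add: W_def)
  finally have "real (card (X \<rightarrow>\<^sub>E (UNIV :: (bool \<times> bool) set))) \<le> (\<Sum>C\<in>W. real (card (S C)))"
    by (metis of_nat_le_iff of_nat_sum)
  moreover have "card (UNIV :: (bool \<times> bool) set) = 4"
    by (simp flip: UNIV_Times_UNIV add: card_cartesian_product)
  ultimately have "4 ^ card X \<le> (\<Sum>C\<in>W. real (card (S C)))"
    using \<open>finite X\<close> by (simp add: card_PiE)
  also have "\<dots> \<le> (\<Sum>C\<in>W. (3/4) ^ d * 4 ^ card X)"
  proof (rule sum_mono)
    fix C assume "C \<in> W"
    then have "clause_vars C \<subseteq> X \<times> UNIV" and "d \<le> card (fst ` clause_vars C)"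
      using over by (auto simp: W_def clauses_over_def)
    then have "real (card (S C)) \<le> (3/4) ^ card (fst ` clause_vars C) * 4 ^ card X"
      unfolding S_def using card_surviving_restrictions \<open>finite X\<close> by blast
    also have "\<dots> \<le> (3/4) ^ d * 4 ^ card X"
      using \<open>d \<le> _\<close> by (intro mult_right_mono power_decreasing) auto
    finally show "real (card (S C)) \<le> (3/4) ^ d * 4 ^ card X" .
  qed
  also have "\<dots> = (real (card W) * (3/4) ^ d) * 4 ^ card X"
    by simp
  finally have "1 \<le> real (card W) * (3/4) ^ d"
    by simp
  \<comment> \<open>The union bound runs over distinct wide clauses, which multiplicities can only
    outnumber.\<close>
  also have "card W \<le> size H"
    using card_mono[of "set_mset H" W] card_set_mset_le_size[of H] by (simp add: W_def)
  then have "real (card W) * (3/4) ^ d \<le> real (size H) * (3/4) ^ d"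
    by (intro mult_right_mono) auto
  also have "\<dots> < (4/3) ^ d * (3/4) ^ d"
    using small by (intro mult_strict_right_mono) auto
  also have "\<dots> = 1"
    by (simp flip: power_mult_distrib)
  finally show False by simp
qed

text \<open>With \<open>d\<close> chosen as the minimum width itself, a smaller \<open>H\<close>
  would restrict to a refutation of \<open>F\<close> narrower than the minimum.\<close>

lemma size_ge_of_min_refutation_width:
  assumes "finite X" and "clauses_over X F"
    and ref: "subcubesums_refutation (X \<times> UNIV) (xorify F) H"
    and "0 < min_refutation_width X F"
  shows "(4/3) ^ min_refutation_width X F \<le> real (size H)"
proof (rule ccontr)
  assume "\<not> ?thesis"
  moreover have H: "clauses_over (X \<times> UNIV) H" "\<forall>C\<in>#H. \<not> tautologous C"
    using ref by (auto simp: subcubesums_refutation_def)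
  ultimately obtain \<rho> where
    "\<forall>C\<in>#H. \<not> satisfied_by \<rho> C \<longrightarrow> card (fst ` clause_vars C) < min_refutation_width X F"
    using exists_restriction_satisfying_wide_clauses[OF assms(1)] by (meson not_le)
  then have "refutation_width (restrict_cnf \<rho> H) < min_refutation_width X F"
    using refutation_width_restrict_cnf_less[OF assms(1,4) H] by blast
  then show False
    using subcubesums_refutation_restrict_cnf[OF assms(1,2) ref, of \<rho>] not_less_Least
    unfolding min_refutation_width_def by blast
qed

theorem theorem4p15:
  "\<exists>\<epsilon>::real. \<epsilon> > 0 \<and> (\<exists>d0::nat.
     \<forall>(X :: 'v set) (F :: 'v clause multiset) (H :: ('v \<times> bool) clause multiset) (d::nat).
       finite X \<longrightarrow> clauses_over X F \<longrightarrow> unsatisfiable F \<longrightarrow>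
       d = min_refutation_width X F \<longrightarrow> d \<ge> d0 \<longrightarrow>
       subcubesums_refutation (X \<times> UNIV) (xorify F) H \<longrightarrow>
       real (size H) \<ge> 2 powr (\<epsilon> * real d))"
\<comment> \<open>This \<epsilon> turns \<open>2 powr (\<epsilon> * d)\<close> into
  \<open>(4/3) ^ d\<close>; the threshold 1 supplies the positive minimum width.\<close>
proof (intro exI[of _ "log 2 (4/3)"] exI[of _ "1::nat"] conjI allI impI)
  show "0 < log 2 (4/3 :: real)" by simp
next
  fix X :: "'v set" and F :: "'v clause multiset"
    and H :: "('v \<times> bool) clause multiset" and d :: nat
  assume "finite X" "clauses_over X F" "d = min_refutation_width X F" "1 \<le> d"
    "subcubesums_refutation (X \<times> UNIV) (xorify F) H"
  then have "(4/3) ^ d \<le> real (size H)"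
    using size_ge_of_min_refutation_width[of X F H] by simp
  moreover have "2 powr (log 2 (4/3) * real d) = (2 powr log 2 (4/3)) powr real d"
    by (simp only: powr_powr)
  then have "2 powr (log 2 (4/3) * real d) = (4/3) ^ d"
    by (simp add: powr_realpow)
  ultimately show "2 powr (log 2 (4/3) * real d) \<le> real (size H)"
    by simp
qed

end
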